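(* Let $z\in{\rm Im}\,\mathbb{H}$. On the sphere $S^3$ the invariant control set for the family $\{X_{(1+z,0,0)},X_{(1-z,0,0)}\}$ is the minimal geodesic segment $C$ joining $$p_1=\frac{1+z}{|1+z|}\quad\text{and}\quad p_2=\frac{1-z}{|1-z|}.$$
   Context: $\mathbb{H}$ denotes the quaternions, ${\rm Im}\,\mathbb{H}$ the purely imaginary quaternions, and $S^3\subset\mathbb{H}$ the unit quaternions with the round metric. For $q\in\mathbb{H}$, $X_{(q,0,0)}$ is the vector field on $S^3$ given by $X_{(q,0,0)}(p)=\frac12(q-p\overline{q}p)=q-\langle q,p\rangle p$. A trajectory of a family $\Gamma$ of vector fields is a continuous curve $\gamma:[0,T]\to S^3$, $T\ge0$, for which there is a finite partition of $[0,T]$ such that on each subinterval $\gamma$ is a (forward-time) integral curve of some element of $\Gamma$. The positive orbit $\mathcal{O}^+(x)$ is the set of endpoints of trajectories of $\Gamma$ starting at $x$. A nonempty set $C\subset S^3$ is an invariant control set of $\Gamma$ if (i) for every $x\in C$ there is a trajectory of $\Gamma$, defined for all $t\ge0$ (a concatenation of forward integral curves of elements of $\Gamma$), starting at $x$ and contained in $C$ for all $t\ge 0$; (ii) $\mathrm{cl}\,C=\mathrm{cl}\,\mathcal{O}^{+}(x)$ for every $x\in C$; (iii) $C$ is maximal with these properties: if $C'\supset C$ satisfies (i) and (ii) then $C'=C$.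
   Formalization: That C is the only invariant control set is claimed only for z ≠ 0: for z = 0 the single field X_{(1,0,0)} vanishes at -1, so {-1} is a second invariant control set besides C = {1}; that C is an invariant control set is kept for all z. *)

theory Defs
  imports "HOL-Analysis.Analysis"
begin

(* A quaternion a + u with scalar part a and vector part u is the pair (a, u). The library's inner
   product and norm on the product type are then the standard ones of the quaternions. *)
type_synonym quat = "real \<times> (real ^ 3)"

definition qone :: quat where
  "qone = (1, 0)"

definition qmult :: "quat \<Rightarrow> quat \<Rightarrow> quat" (infixl "\<odot>" 70) where
  "p \<odot> q = (fst p * fst q - snd p \<bullet> snd q,
            fst p *\<^sub>R snd q + fst q *\<^sub>R snd p + cross3 (snd p) (snd q))"

definition qcnj :: "quat \<Rightarrow> quat" where
  "qcnj q = (fst q, - snd q)"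

definition ImH :: "quat set" where
  "ImH = {q. fst q = 0}"

abbreviation S3 :: "quat set" where
  "S3 \<equiv> sphere 0 1"

(* The vector field with parameters (q,0,0), as a map on all quaternions; only its values on S3,
   where it is tangent, are used. *)
definition vfield :: "quat \<Rightarrow> quat \<Rightarrow> quat" where
  "vfield q p = (1/2) *\<^sub>R (q - p \<odot> qcnj q \<odot> p)"

lemma vfield_eq_projection:
  assumes "p \<in> S3"
  shows "vfield q p = q - (q \<bullet> p) *\<^sub>R p"
proof -
  obtain a u where p: "p = (a, u)" by (cases p)
  obtain b v where q: "q = (b, v)" by (cases q)
  have "p \<bullet> p = 1"
    using assms by (simp add: dot_square_norm)
  hence n: "a * a + u \<bullet> u = 1"
    by (simp add: p)
  have a2: "a * a = 1 - u \<bullet> u" using n by simp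
  have cr: "cross3 (cross3 u v) u = (u \<bullet> u) *\<^sub>R v - (u \<bullet> v) *\<^sub>R u"
    by (simp add: cross3_def inner_vec_def sum_3 vec_eq_iff forall_3 algebra_simps)
  have pr: "p \<odot> qcnj q \<odot> p
      = ((a * b + u \<bullet> v) * a - (b *\<^sub>R u - a *\<^sub>R v - cross3 u v) \<bullet> u,
         (a * b + u \<bullet> v) *\<^sub>R u + a *\<^sub>R (b *\<^sub>R u - a *\<^sub>R v - cross3 u v)
         + cross3 (b *\<^sub>R u - a *\<^sub>R v - cross3 u v) u)"
    by (simp add: qmult_def qcnj_def p q)
  have sc: "(a * b + u \<bullet> v) * a - (b *\<^sub>R u - a *\<^sub>R v - cross3 u v) \<bullet> u = 2 * (a * b + u \<bullet> v) * a - b"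
  proof -
    have "(a * b + u \<bullet> v) * a - (b *\<^sub>R u - a *\<^sub>R v - cross3 u v) \<bullet> u
       = (a * b + u \<bullet> v) * a + a * (u \<bullet> v) - b * (u \<bullet> u)"
      by (simp add: inner_diff_left inner_diff_right dot_cross_self inner_commute)
    also have "u \<bullet> u = 1 - a * a" using n by simp
    finally show ?thesis by (simp add: algebra_simps)
  qed
  have vc: "(a * b + u \<bullet> v) *\<^sub>R u + a *\<^sub>R (b *\<^sub>R u - a *\<^sub>R v - cross3 u v)
         + cross3 (b *\<^sub>R u - a *\<^sub>R v - cross3 u v) u = (2 * (a * b + u \<bullet> v)) *\<^sub>R u - v"
  proof -
    have h: "cross3 (b *\<^sub>R u - a *\<^sub>R v - cross3 u v) u
        = a *\<^sub>R cross3 u v - cross3 (cross3 u v) u"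
      by (simp add: cross3_def inner_vec_def sum_3 vec_eq_iff forall_3 algebra_simps)
    have "(a * b + u \<bullet> v) *\<^sub>R u + a *\<^sub>R (b *\<^sub>R u - a *\<^sub>R v - cross3 u v)
         + cross3 (b *\<^sub>R u - a *\<^sub>R v - cross3 u v) u
       = (2 * (a * b + u \<bullet> v)) *\<^sub>R u - (a * a + u \<bullet> u) *\<^sub>R v"
      unfolding h cr by (simp add: vec_eq_iff algebra_simps)
    thus ?thesis by (simp add: n)
  qed
  show ?thesis
    unfolding vfield_def pr sc vc
    by (simp add: p q inner_commute vec_eq_iff field_simps)
qed

definition integral_curve_on :: "(quat \<Rightarrow> quat) \<Rightarrow> real \<Rightarrow> real \<Rightarrow> (real \<Rightarrow> quat) \<Rightarrow> bool" where
  "integral_curve_on X a b \<gamma> \<longleftrightarrow>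
     (\<forall>s\<in>{a..b}. (\<gamma> has_vector_derivative X (\<gamma> s)) (at s within {a..b}))"

definition trajectory :: "(quat \<Rightarrow> quat) set \<Rightarrow> real \<Rightarrow> (real \<Rightarrow> quat) \<Rightarrow> bool" where
  "trajectory \<Gamma> T \<gamma> \<longleftrightarrow> 0 \<le> T \<and> continuous_on {0..T} \<gamma> \<and> \<gamma> ` {0..T} \<subseteq> S3 \<and>
     (\<exists>(n::nat) t. t 0 = 0 \<and> t n = T \<and> (\<forall>i<n. t i < t (Suc i)) \<and>
        (\<forall>i<n. \<exists>X\<in>\<Gamma>. integral_curve_on X (t i) (t (Suc i)) \<gamma>))"

definition positive_orbit :: "(quat \<Rightarrow> quat) set \<Rightarrow> quat \<Rightarrow> quat set" where
  "positive_orbit \<Gamma> x = {y. \<exists>T \<gamma>. trajectory \<Gamma> T \<gamma> \<and> \<gamma> 0 = x \<and> \<gamma> T = y}"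

(* A concatenation of integral curves on all of [0,oo) is one with finitely many switches on every
   bounded interval. *)
definition infinite_trajectory :: "(quat \<Rightarrow> quat) set \<Rightarrow> (real \<Rightarrow> quat) \<Rightarrow> bool" where
  "infinite_trajectory \<Gamma> \<gamma> \<longleftrightarrow> (\<forall>T\<ge>0. trajectory \<Gamma> T \<gamma>)"

definition viable :: "(quat \<Rightarrow> quat) set \<Rightarrow> quat set \<Rightarrow> bool" where
  "viable \<Gamma> C \<longleftrightarrow>
     (\<forall>x\<in>C. \<exists>\<gamma>. infinite_trajectory \<Gamma> \<gamma> \<and> \<gamma> 0 = x \<and> (\<forall>t\<ge>0. \<gamma> t \<in> C))"

definition orbit_dense :: "(quat \<Rightarrow> quat) set \<Rightarrow> quat set \<Rightarrow> bool" where
  "orbit_dense \<Gamma> C \<longleftrightarrow> (\<forall>x\<in>C. closure C = closure (positive_orbit \<Gamma> x))"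

definition invariant_control_set :: "(quat \<Rightarrow> quat) set \<Rightarrow> quat set \<Rightarrow> bool" where
  "invariant_control_set \<Gamma> C \<longleftrightarrow> C \<noteq> {} \<and> C \<subseteq> S3 \<and> viable \<Gamma> C \<and> orbit_dense \<Gamma> C \<and>
     (\<forall>C'. C \<subseteq> C' \<and> C' \<subseteq> S3 \<and> viable \<Gamma> C' \<and> orbit_dense \<Gamma> C' \<longrightarrow> C' = C)"

(* Unit speed geodesic on [0,L]: the covariant derivative of the velocity, i.e. the component of
   the acceleration tangent to the sphere, vanishes. For L = 0 this is a constant curve. *)
definition unit_speed_geodesic :: "real \<Rightarrow> (real \<Rightarrow> quat) \<Rightarrow> bool" where
  "unit_speed_geodesic L \<gamma> \<longleftrightarrow> 0 \<le> L \<and>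
     (\<exists>\<gamma>1 \<gamma>2. \<forall>s\<in>{0..L}. \<gamma> s \<in> S3 \<and>
        (\<gamma> has_vector_derivative \<gamma>1 s) (at s within {0..L}) \<and> norm (\<gamma>1 s) = 1 \<and>
        (\<gamma>1 has_vector_derivative \<gamma>2 s) (at s within {0..L}) \<and>
        (\<forall>v. v \<bullet> \<gamma> s = 0 \<longrightarrow> \<gamma>2 s \<bullet> v = 0))"

(* The library's piecewise C1 paths may have unbounded speed; has_integral (rather than integral,
   which is 0 if the integral does not exist) leaves curves of infinite length without a length. *)
definition has_length :: "(real \<Rightarrow> quat) \<Rightarrow> real \<Rightarrow> bool" where
  "has_length g l \<longleftrightarrow> ((\<lambda>t. norm (vector_derivative g (at t))) has_integral l) {0..1}"

definition minimal_geodesic_segment :: "quat \<Rightarrow> quat \<Rightarrow> quat set \<Rightarrow> bool" where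
  "minimal_geodesic_segment p q C \<longleftrightarrow>
     (\<exists>L \<gamma>. unit_speed_geodesic L \<gamma> \<and> \<gamma> 0 = p \<and> \<gamma> L = q \<and> C = \<gamma> ` {0..L} \<and>
        (\<forall>g l. valid_path g \<and> path_image g \<subseteq> S3 \<and> pathstart g = p \<and> pathfinish g = q \<and>
           has_length g l \<longrightarrow> L \<le> l))"

end

theory Submission
  imports Defs "HOL-Real_Asymp.Real_Asymp"
begin

text \<open>
  On the sphere the field with parameter \<open>q = N u\<close>, \<open>u\<close> a unit vector, is \<open>N (u - (u \<bullet> p) p)\<close>,
  the gradient of the height \<open>q \<bullet> p\<close>. Its flow lines are great circle arcs from \<open>- u\<close> to \<open>u\<close>, and
  every point except \<open>- u\<close> is attracted to \<open>u\<close>. The two fields of the theorem have the attractors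
  \<open>p1\<close> and \<open>p2\<close>, which are never antipodal because both have a positive scalar part. So a trajectory
  is a curve that is pulled alternately towards \<open>p1\<close> and towards \<open>p2\<close>.

  The convexity behind the theorem is this: if \<open>v\<close> has nonnegative inner product with \<open>p1\<close> and with
  \<open>p2\<close>, then the half-space \<open>v \<bullet> x \<ge> 0\<close> cannot be left in forward time
  (\<open>positive_orbit_halfspace\<close>), since \<open>v \<bullet> x\<close> satisfies a scalar linear differential equation with
  nonnegative forcing term. The intersection of the sphere with all these half-spaces is the segment
  \<open>C\<close> (\<open>spherical_segment_arc_dual\<close>), so \<open>C\<close> is forward invariant. Conversely the flow towards \<open>p1\<close>
  brings almost every point arbitrarily near to \<open>p1\<close>, and the flow towards \<open>p2\<close> sweeps \<open>p1\<close> along the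
  whole segment; by continuity of the flow, \<open>C\<close> lies in the closure of every positive orbit that
  contains a point other than \<open>- p1\<close> (\<open>spherical_segment_subset_closure_positive_orbit\<close>). Both
  inclusions give \<open>cl O(x) = C\<close> for \<open>x\<close> in \<open>C\<close>, and hence that \<open>C\<close> is an invariant control set.

  For uniqueness suppose \<open>z \<noteq> 0\<close> and let \<open>D\<close> be an invariant control set. The equilibrium
  \<open>- p1\<close> of the first field is no obstacle, because the other field moves that point, so \<open>p1\<close> lies in the closure of \<open>D\<close>. If
  \<open>v \<bullet> p1\<close> and \<open>v \<bullet> p2\<close> are nonnegative, they become positive when a small multiple of \<open>p1 + p2\<close> is
  added to \<open>v\<close>; then \<open>D\<close> has a point \<open>y\<close> in the open half-space, its orbit stays in the closed one,
  and so does \<open>D\<close>, as it lies in the closure of this orbit. Thus \<open>D\<close> is contained in \<open>C\<close>, and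
  maximality of \<open>D\<close> makes them equal. For \<open>z = 0\<close> uniqueness fails: the only field vanishes
  at the point \<open>- p1\<close>, which then forms a second invariant control set.

  That \<open>C\<close> is the one and only minimal geodesic segment rests on two facts: a unit speed geodesic
  satisfies \<open>\<gamma>'' = - \<gamma>\<close> and is therefore a great circle, and no path on the sphere is shorter than
  the angle between its endpoints.
\<close>

section \<open>The segment as an arc, as a cone and as an intersection of half-spaces\<close>

text \<open>
  The cone form makes the segment easy to reach by the flow, while the dual form in the lemmas below
  makes it easy to prove forward invariant.
\<close>

definition spherical_segment :: "'a::real_inner \<Rightarrow> 'a \<Rightarrow> 'a set" where
  "spherical_segment p q = {x \<in> sphere 0 1. \<exists>a\<ge>0. \<exists>b\<ge>0. x = a *\<^sub>R p + b *\<^sub>R q}"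

lemma abs_inner_unit_le_1:
  fixes p q :: "'a::real_inner"
  assumes "norm p = 1" "norm q = 1"
  shows "\<bar>p \<bullet> q\<bar> \<le> 1"
  using Cauchy_Schwarz_ineq2[of p q] assms by simp

lemma unit_inner_minus_one:
  fixes p q :: "'a::real_inner"
  assumes "norm p = 1" "norm q = 1" "p \<bullet> q = -1"
  shows "p = - q"
proof -
  have "(p + q) \<bullet> (p + q) = 0"
    using assms by (simp add: inner_add_left inner_add_right inner_commute norm_eq_1)
  then show ?thesis by (simp add: eq_neg_iff_add_eq_0)
qed

lemma cos_add_sin_in_sphere:
  fixes p w :: "'a::real_inner"
  assumes "norm p = 1" "norm w = 1" "p \<bullet> w = 0"
  shows "norm (cos s *\<^sub>R p + sin s *\<^sub>R w) = 1"
  using assms sin_cos_squared_add[of s]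
  by (simp add: norm_eq_1 inner_add_left inner_add_right inner_commute power2_eq_square)

text \<open>
  The angle \<open>\<theta>\<close> and a unit vector \<open>w\<close> orthogonal to \<open>p\<close> are polar coordinates of \<open>q\<close> about \<open>p\<close>. For
  \<open>q = p\<close> the direction \<open>w\<close> is arbitrary, and the dimension must be at least two for it to exist.
\<close>

lemma orthonormal_direction:
  fixes p q :: "'a::euclidean_space"
  assumes "2 \<le> DIM('a)" "norm p = 1" "norm q = 1" "p \<noteq> - q"
  obtains \<theta> w where "0 \<le> \<theta>" "\<theta> < pi" "norm w = 1" "p \<bullet> w = 0"
    "q = cos \<theta> *\<^sub>R p + sin \<theta> *\<^sub>R w"
proof -
  let ?c = "p \<bullet> q"
  have c: "-1 < ?c" "?c \<le> 1"
    using abs_inner_unit_le_1[of p q] unit_inner_minus_one[of p q] assms by (fastforce simp: abs_le_iff)+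
  define \<theta> where "\<theta> = arccos ?c"
  have cos: "cos \<theta> = ?c" using c by (simp add: \<theta>_def)
  have \<theta>: "0 \<le> \<theta>" "\<theta> < pi"
    using c arccos_lbound[of ?c] arccos_lt_bounded[of ?c]
    by (cases "?c = 1"; simp add: \<theta>_def)+
  show thesis
  proof (cases "\<theta> = 0")
    case True
    obtain y where y: "y \<noteq> 0" "orthogonal p y"
      using orthogonal_to_vector_exists assms(1) by blast
    have "(p - q) \<bullet> (p - q) = 0"
      using assms cos True by (simp add: inner_diff_left inner_diff_right inner_commute norm_eq_1)
    then have "q = p" by simp
    then show thesis
      using that[of 0 "y /\<^sub>R norm y"] y by (simp add: orthogonal_def)
  next
    case False
    then have s: "sin \<theta> > 0" using \<theta> by (simp add: sin_gt_zero)
    define w where "w = (q - cos \<theta> *\<^sub>R p) /\<^sub>R sin \<theta>"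
    have pp: "p \<bullet> p = 1" "q \<bullet> q = 1" using assms by (simp_all add: norm_eq_1)
    have "(q - cos \<theta> *\<^sub>R p) \<bullet> (q - cos \<theta> *\<^sub>R p) = 1 - (cos \<theta>)\<^sup>2"
      using pp cos by (simp add: inner_diff_left inner_diff_right inner_commute power2_eq_square)
    also have "\<dots> = (sin \<theta>)\<^sup>2" by (simp add: sin_squared_eq)
    finally have n: "norm (q - cos \<theta> *\<^sub>R p) = sin \<theta>" using s by (simp add: norm_eq_sqrt_inner)
    show thesis
    proof (rule that[OF \<theta>])
      show "norm w = 1" using n s by (simp add: w_def)
      show "p \<bullet> w = 0" using pp cos by (simp add: w_def inner_diff_right)
      show "q = cos \<theta> *\<^sub>R p + sin \<theta> *\<^sub>R w" using s by (simp add: w_def)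
    qed
  qed
qed

text \<open>
  The arc is contained in the cone by the sine rule, and the cone trivially in the dual set. For the
  way back finitely many test vectors \<open>v\<close> are enough: the component of \<open>x\<close> orthogonal to \<open>p\<close> and \<open>w\<close>,
  with both signs, forces \<open>x\<close> into their plane; \<open>w\<close> puts it into the right half of the great circle;
  and \<open>sin \<theta> *\<^sub>R p - cos \<theta> *\<^sub>R w\<close>, which is orthogonal to \<open>q\<close>, keeps it on the near side of \<open>q\<close>.
\<close>

lemma spherical_segment_arc_dual:
  fixes p q w :: "'a::real_inner"
  assumes p: "norm p = 1" and w: "norm w = 1" and pw: "p \<bullet> w = 0"
    and \<theta>: "0 \<le> \<theta>" "\<theta> < pi" and q: "q = cos \<theta> *\<^sub>R p + sin \<theta> *\<^sub>R w"
  shows "(\<lambda>s. cos s *\<^sub>R p + sin s *\<^sub>R w) ` {0..\<theta>} = spherical_segment p q" (is "?A = _")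
    and "spherical_segment p q = {x \<in> sphere 0 1. \<forall>v. 0 \<le> v \<bullet> p \<longrightarrow> 0 \<le> v \<bullet> q \<longrightarrow> 0 \<le> v \<bullet> x}"
      (is "_ = ?D")
proof -
  have pp: "p \<bullet> p = 1" "w \<bullet> w = 1" "w \<bullet> p = 0"
    using p w pw by (simp_all add: norm_eq_1 inner_commute)
  have AC: "?A \<subseteq> spherical_segment p q"
  proof
    fix x assume "x \<in> ?A"
    then obtain s where s: "0 \<le> s" "s \<le> \<theta>" "x = cos s *\<^sub>R p + sin s *\<^sub>R w" by auto
    have n: "x \<in> sphere 0 1" using cos_add_sin_in_sphere[OF p w pw] s by simp
    show "x \<in> spherical_segment p q"
    proof (cases "\<theta> = 0")
      case True
      then have "x = 1 *\<^sub>R p + 0 *\<^sub>R q" using s by simp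
      then show ?thesis
        unfolding spherical_segment_def using n by (smt (verit) mem_Collect_eq)
    next
      case False
      then have sp: "sin \<theta> > 0" using \<theta> by (simp add: sin_gt_zero)
      have "sin (\<theta> - s) / sin \<theta> + sin s / sin \<theta> * cos \<theta> = cos s"
        using sp by (simp add: sin_diff diff_divide_distrib)
      then have "x = (sin (\<theta> - s) / sin \<theta>) *\<^sub>R p + (sin s / sin \<theta>) *\<^sub>R q"
        using sp unfolding s q scaleR_add_right scaleR_scaleR add.assoc[symmetric]
          scaleR_left_distrib[symmetric] by simp
      moreover have "0 \<le> sin (\<theta> - s) / sin \<theta>" "0 \<le> sin s / sin \<theta>"
        using sp s \<theta> by (simp_all add: sin_ge_zero)
      ultimately show ?thesis unfolding spherical_segment_def using n by blast
    qed
  qed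
  have CD: "spherical_segment p q \<subseteq> ?D"
    by (auto simp: spherical_segment_def inner_add_right)
  have DA: "?D \<subseteq> ?A"
  proof
    fix x assume x: "x \<in> ?D"
    then have xx: "x \<bullet> x = 1" by (simp add: norm_eq_1)
    have dual: "0 \<le> v \<bullet> x" if "0 \<le> v \<bullet> p" "0 \<le> v \<bullet> q" for v using x that by blast
    define \<alpha> \<beta> where "\<alpha> = p \<bullet> x" and "\<beta> = w \<bullet> x"
    define y where "y = x - \<alpha> *\<^sub>R p - \<beta> *\<^sub>R w"
    have y: "y \<bullet> p = 0" "y \<bullet> w = 0"
      using pp pw by (simp_all add: y_def inner_diff_left \<alpha>_def \<beta>_def inner_commute[of x])
    \<comment> \<open>The test vector \<open>- y\<close>, orthogonal to \<open>p\<close> and \<open>q\<close>, shows that \<open>y\<close> vanishes.\<close>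
    have "y \<bullet> y = y \<bullet> x - \<alpha> * (y \<bullet> p) - \<beta> * (y \<bullet> w)"
      by (simp add: y_def inner_diff_right)
    moreover have "0 \<le> (- y) \<bullet> x" using y by (intro dual) (simp_all add: q inner_add_right)
    ultimately have "y \<bullet> y \<le> 0" using y by simp
    then have "y = 0" using inner_gt_zero_iff[of y] by linarith
    then have xe: "x = \<alpha> *\<^sub>R p + \<beta> *\<^sub>R w" by (simp add: y_def algebra_simps)
    have ab: "\<alpha>\<^sup>2 + \<beta>\<^sup>2 = 1"
      using xx pp pw by (simp add: xe inner_add_left inner_add_right power2_eq_square)
    have \<beta>: "0 \<le> \<beta>"
      unfolding \<beta>_def using pp sin_ge_zero \<theta> by (intro dual) (simp_all add: q inner_add_right)
    have "\<alpha>\<^sup>2 \<le> 1" using ab zero_le_power2[of \<beta>] by linarith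
    then have a1: "\<bar>\<alpha>\<bar> \<le> 1" by (simp add: abs_square_le_1)
    define s where "s = arccos \<alpha>"
    have s: "cos s = \<alpha>" "0 \<le> s" "s \<le> pi"
      using a1 by (simp_all add: s_def abs_le_iff cos_arccos_abs arccos_lbound arccos_ubound)
    have "sin s = \<beta>"
      using a1 ab \<beta> by (simp add: s_def sin_arccos_abs abs_le_iff real_sqrt_unique)
    have "s \<le> \<theta>"
    proof (cases "\<theta> = 0")
      case True
      then have "q = p" using q by simp
      \<comment> \<open>If \<open>q = p\<close>, then \<open>- w\<close> is a test vector too, and \<open>p\<close> excludes the antipode.\<close>
      have "0 \<le> (- w) \<bullet> x" using pp \<open>q = p\<close> by (intro dual) simp_all
      then have "\<beta> = 0" using \<beta> by (simp add: \<beta>_def)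
      moreover have "0 \<le> \<alpha>" unfolding \<alpha>_def using pp \<open>q = p\<close> by (intro dual) simp_all
      ultimately have "\<alpha> = 1" using ab by (simp add: power2_eq_1_iff)
      then show ?thesis using True by (simp add: s_def)
    next
      case False
      have "0 \<le> (sin \<theta> *\<^sub>R p - cos \<theta> *\<^sub>R w) \<bullet> x"
        using pp pw sin_ge_zero \<theta> by (intro dual) (simp_all add: q inner_diff_left inner_add_right)
      then have "0 \<le> sin (\<theta> - s)"
        by (simp add: sin_diff s \<open>sin s = \<beta>\<close> inner_diff_left \<alpha>_def \<beta>_def)
      then have "\<not> 0 < sin (s - \<theta>)" using sin_minus[of "s - \<theta>"] by simp
      then show ?thesis using sin_gt_zero[of "s - \<theta>"] s \<theta> False by linarith
    qed
    then have "s \<in> {0..\<theta>}" "x = cos s *\<^sub>R p + sin s *\<^sub>R w"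
      using s xe \<open>sin s = \<beta>\<close> by simp_all
    then show "x \<in> ?A" by blast
  qed
  show "?A = spherical_segment p q" by (rule subset_antisym[OF AC subset_trans[OF CD DA]])
  show "spherical_segment p q = ?D" by (rule subset_antisym[OF CD subset_trans[OF DA AC]])
qed

section \<open>The flow towards a pole of the sphere\<close>

text \<open>
  This is the time-\<open>t\<close> flow of \<open>p \<mapsto> u - (u \<bullet> p) p\<close> in closed form. With \<open>c = u \<bullet> x\<close> the initial
  height, the denominator \<open>d\<close> and the coefficient \<open>k\<close> of \<open>u\<close> satisfy \<open>k' = d\<close> and \<open>d' = c + k\<close>,
  which is all that the differential equation needs: the height at time \<open>t\<close> is \<open>(c + k) / d\<close>.
\<close>

definition flow :: "'a::real_inner \<Rightarrow> real \<Rightarrow> 'a \<Rightarrow> 'a" where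
  "flow u t x = (x + (sinh t + (u \<bullet> x) * (cosh t - 1)) *\<^sub>R u) /\<^sub>R (cosh t + (u \<bullet> x) * sinh t)"

lemma flow_denominator_pos:
  fixes c t :: real
  assumes "\<bar>c\<bar> \<le> 1"
  shows "0 < cosh t + c * sinh t"
proof -
  have "\<bar>c * sinh t\<bar> \<le> \<bar>sinh t\<bar>"
    using mult_right_mono[OF assms, of "\<bar>sinh t\<bar>"] by (simp add: abs_mult)
  also have "\<dots> < cosh t"
    using cosh_plus_sinh[of t] cosh_minus_sinh[of t] exp_gt_zero[of t] exp_gt_zero[of "-t"] by linarith
  finally show ?thesis by linarith
qed

lemma flow_0: "flow u 0 x = x"
  by (simp add: flow_def)

lemma norm_flow:
  fixes u x :: "'a::real_inner"
  assumes u: "norm u = 1" and x: "norm x = 1"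
  shows "norm (flow u t x) = 1"
proof -
  define c where "c = u \<bullet> x"
  define k where "k = sinh t + c * (cosh t - 1)"
  define d where "d = cosh t + c * sinh t"
  have d: "0 < d" unfolding d_def c_def by (rule flow_denominator_pos[OF abs_inner_unit_le_1[OF u x]])
  have uu: "u \<bullet> u = 1" "x \<bullet> x = 1" using u x by (simp_all add: norm_eq_1)
  have "(x + k *\<^sub>R u) \<bullet> (x + k *\<^sub>R u) = 1 + 2 * k * c + k\<^sup>2"
    using uu by (simp add: inner_add_left inner_add_right c_def inner_commute power2_eq_square)
  also have "\<dots> = d\<^sup>2"
    using cosh_square_eq[of t] unfolding k_def d_def by algebra
  finally have "norm (x + k *\<^sub>R u) = d" using d by (simp add: norm_eq_sqrt_inner)
  then show ?thesis using d by (simp add: flow_def c_def[symmetric] k_def[symmetric] d_def[symmetric])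
qed

lemma has_vector_derivative_flow:
  fixes u x :: "'a::real_inner"
  assumes u: "norm u = 1" and x: "norm x = 1"
  shows "((\<lambda>t. flow u t x) has_vector_derivative u - (u \<bullet> flow u t x) *\<^sub>R flow u t x) (at t within S)"
proof -
  define c where "c = u \<bullet> x"
  define k where "k = (\<lambda>t. sinh t + c * (cosh t - 1))"
  define d where "d = (\<lambda>t. cosh t + c * sinh t)"
  have d: "0 < d t" for t unfolding d_def c_def by (rule flow_denominator_pos[OF abs_inner_unit_le_1[OF u x]])
  have uu: "u \<bullet> u = 1" using u by (simp add: norm_eq_1)
  have f: "flow u t x = inverse (d t) *\<^sub>R (x + k t *\<^sub>R u)" for t
    by (simp add: flow_def c_def[symmetric] k_def d_def)
  have k': "(k has_real_derivative d t) (at t within S)"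
    unfolding k_def d_def by (auto intro!: derivative_eq_intros)
  have d': "(d has_real_derivative c + k t) (at t within S)"
    unfolding k_def d_def by (auto intro!: derivative_eq_intros simp: algebra_simps)
  have i': "((\<lambda>t. inverse (d t)) has_real_derivative - ((c + k t) / (d t)\<^sup>2)) (at t within S)"
    using d[of t] by (auto intro!: derivative_eq_intros d' simp: power2_eq_square field_simps)
  have e: "u \<bullet> flow u t x = (c + k t) / d t"
    using uu by (simp add: f inner_add_right c_def divide_inverse mult.commute)
  have "((\<lambda>t. x + k t *\<^sub>R u) has_vector_derivative d t *\<^sub>R u) (at t within S)"
    using k' by (auto intro!: derivative_eq_intros)
  note has_vector_derivative_scaleR[OF i' this]
  moreover have "inverse (d t) *\<^sub>R d t *\<^sub>R u + - ((c + k t) / (d t)\<^sup>2) *\<^sub>R (x + k t *\<^sub>R u)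
      = u - ((c + k t) / d t) *\<^sub>R (inverse (d t) *\<^sub>R (x + k t *\<^sub>R u))"
    using d[of t] by (simp add: power2_eq_square divide_inverse)
  ultimately show ?thesis unfolding e by (simp only: f)
qed

text \<open>
  Away from \<open>- u\<close> the initial height \<open>c\<close> exceeds \<open>-1\<close>; then \<open>d\<close> tends to infinity and \<open>k / d\<close> to \<open>1\<close>.
\<close>

lemma flow_tendsto:
  fixes u x :: "'a::real_inner"
  assumes u: "norm u = 1" and x: "norm x = 1" and ne: "x \<noteq> - u"
  shows "((\<lambda>t. flow u t x) \<longlongrightarrow> u) at_top"
proof -
  define c where "c = u \<bullet> x"
  have c: "c > -1"
    using abs_inner_unit_le_1[OF u x] unit_inner_minus_one[OF x u] ne by (fastforce simp: c_def inner_commute)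
  have "((\<lambda>t. inverse (cosh t + c * sinh t)) \<longlongrightarrow> 0) at_top"
    using c unfolding cosh_def sinh_def by simp real_asymp
  moreover have "((\<lambda>t. inverse (cosh t + c * sinh t) * (sinh t + c * (cosh t - 1))) \<longlongrightarrow> 1) at_top"
    using c unfolding cosh_def sinh_def by simp real_asymp
  ultimately have "((\<lambda>t. inverse (cosh t + c * sinh t) *\<^sub>R x +
      (inverse (cosh t + c * sinh t) * (sinh t + c * (cosh t - 1))) *\<^sub>R u) \<longlongrightarrow> 0 *\<^sub>R x + 1 *\<^sub>R u) at_top"
    by (intro tendsto_intros)
  then show ?thesis by (simp add: flow_def scaleR_add_right c_def)
qed

lemma continuous_on_flow:
  fixes u :: "'a::real_inner"
  assumes u: "norm u = 1"
  shows "continuous_on (sphere 0 1) (flow u t)"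
proof -
  have "cosh t + (u \<bullet> x) * sinh t \<noteq> 0" if "x \<in> sphere 0 1" for x
    using flow_denominator_pos[OF abs_inner_unit_le_1[OF u, of x], of t] that by simp
  then show ?thesis unfolding flow_def by (intro continuous_intros) auto
qed

section \<open>Trajectories and positive orbits\<close>

lemma vfield_scaled:
  assumes "p \<in> S3"
  shows "vfield (N *\<^sub>R u) p = N *\<^sub>R (u - (u \<bullet> p) *\<^sub>R p)"
  using vfield_eq_projection[OF assms] by (simp add: scaleR_diff_right)

lemma integral_curve_on_flow:
  assumes u: "norm u = 1" and x: "norm x = 1"
  shows "integral_curve_on (vfield (N *\<^sub>R u)) a b (\<lambda>t. flow u (N * t) x)"
  unfolding integral_curve_on_def
proof
  fix t
  have "((*) N has_vector_derivative N) (at t)"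
    by (auto intro!: derivative_eq_intros simp flip: has_real_derivative_iff_has_vector_derivative)
  from vector_diff_chain_at[OF this has_vector_derivative_flow[OF u x]]
  show "((\<lambda>t. flow u (N * t) x) has_vector_derivative vfield (N *\<^sub>R u) (flow u (N * t) x))
      (at t within {a..b})"
    using norm_flow[OF u x] by (simp add: vfield_scaled o_def has_vector_derivative_at_within)
qed

lemma continuous_on_integral_curve:
  "integral_curve_on X a b \<gamma> \<Longrightarrow> continuous_on {a..b} \<gamma>"
  unfolding integral_curve_on_def
  by (rule continuous_on_vector_derivative[where f' = "\<lambda>s. X (\<gamma> s)"]) blast

lemma switching_time_le:
  fixes t :: "nat \<Rightarrow> real"
  assumes "\<And>i. i < n \<Longrightarrow> t i < t (Suc i)" "i \<le> j" "j \<le> n"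
  shows "t i \<le> t j"
  using assms(2,3)
proof (induction j rule: dec_induct)
  case (step j)
  then show ?case using assms(1)[of j] by simp
qed simp

text \<open>
  Positive orbits are closed under the flows of the family because an integral curve can be attached,
  after a time shift, at the end of a trajectory. It adds one switching time.
\<close>

lemma trajectory_append:
  assumes \<gamma>: "trajectory \<Gamma> T \<gamma>" and X: "X \<in> \<Gamma>" and s: "0 < s"
    and \<sigma>: "integral_curve_on X 0 s \<sigma>" "\<sigma> 0 = \<gamma> T" "\<sigma> ` {0..s} \<subseteq> S3"
  shows "trajectory \<Gamma> (T + s) (\<lambda>r. if r \<le> T then \<gamma> r else \<sigma> (r - T))" (is "trajectory _ _ ?\<delta>")
proof -
  from \<gamma> obtain n t where T: "0 \<le> T" and c: "continuous_on {0..T} \<gamma>" and S: "\<gamma> ` {0..T} \<subseteq> S3"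
    and t: "t 0 = 0" "t n = T" "\<And>i. i < n \<Longrightarrow> t i < t (Suc i)"
    and X': "\<And>i. i < n \<Longrightarrow> \<exists>X\<in>\<Gamma>. integral_curve_on X (t i) (t (Suc i)) \<gamma>"
    unfolding trajectory_def by blast
  \<comment> \<open>Both formulas hold at the junction \<open>r = T\<close>, so each piece has one formula on a closed interval.\<close>
  have old: "?\<delta> r = \<gamma> r" if "r \<le> T" for r using that by simp
  have new: "?\<delta> r = \<sigma> (r - T)" if "T \<le> r" for r using that \<sigma>(2) by auto
  define t' where "t' = (\<lambda>i. if i \<le> n then t i else T + s)"
  have pieces: "\<exists>X\<in>\<Gamma>. integral_curve_on X (t' i) (t' (Suc i)) ?\<delta>" if i: "i < Suc n" for i
  proof (cases "i = n")
    case False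
    with i have i: "i < n" by simp
    then obtain Y where Y: "Y \<in> \<Gamma>" "integral_curve_on Y (t i) (t (Suc i)) \<gamma>" using X' by blast
    have le: "r \<le> T" if "r \<in> {t i..t (Suc i)}" for r
      using that switching_time_le[of n t "Suc i" n] t i by force
    have "integral_curve_on Y (t i) (t (Suc i)) ?\<delta>"
      unfolding integral_curve_on_def
    proof
      fix r assume r: "r \<in> {t i..t (Suc i)}"
      then have "(\<gamma> has_vector_derivative Y (?\<delta> r)) (at r within {t i..t (Suc i)})"
        using Y(2) le[OF r] by (simp add: integral_curve_on_def)
      then show "(?\<delta> has_vector_derivative Y (?\<delta> r)) (at r within {t i..t (Suc i)})"
        by (rule has_vector_derivative_transform[OF r, rotated]) (use le in auto)
    qed
    then show ?thesis using Y(1) i by (auto simp: t'_def)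
  next
    case True
    have "integral_curve_on X T (T + s) ?\<delta>"
      unfolding integral_curve_on_def
    proof
      fix r assume r: "r \<in> {T..T + s}"
      have im: "(\<lambda>r. r - T) ` {T..T + s} = {0..s}" by (simp add: image_diff_atLeastAtMost)
      have d: "((\<lambda>r. r - T) has_vector_derivative 1) (at r within {T..T + s})"
        by (auto intro!: derivative_eq_intros)
      have \<sigma>': "(\<sigma> has_vector_derivative X (\<sigma> (r - T))) (at (r - T) within (\<lambda>r. r - T) ` {T..T + s})"
        using \<sigma>(1) r by (simp only: im integral_curve_on_def) simp
      have \<delta>r: "?\<delta> r = \<sigma> (r - T)" by (rule new) (use r in simp)
      from vector_diff_chain_within[OF d \<sigma>']
      have "((\<lambda>r. \<sigma> (r - T)) has_vector_derivative X (?\<delta> r)) (at r within {T..T + s})"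
        unfolding \<delta>r by (simp add: o_def)
      then show "(?\<delta> has_vector_derivative X (?\<delta> r)) (at r within {T..T + s})"
        by (rule has_vector_derivative_transform[OF r, rotated]) (rule new, simp)
    qed
    then show ?thesis using X True t(2) by (auto simp: t'_def)
  qed
  have mono: "t' i < t' (Suc i)" if "i < Suc n" for i
    using that t s by (auto simp: t'_def less_Suc_eq not_less_eq_eq)
  have cont: "continuous_on ({0..T} \<union> {T..T + s}) ?\<delta>"
  proof (rule continuous_on_closed_Un)
    show "continuous_on {0..T} ?\<delta>" using c by (rule continuous_on_eq) simp
    have "continuous_on {T..T + s} (\<lambda>r. \<sigma> (r - T))"
      by (rule continuous_on_compose2[OF continuous_on_integral_curve[OF \<sigma>(1)]])
        (auto intro!: continuous_intros)
    then show "continuous_on {T..T + s} ?\<delta>" by (rule continuous_on_eq) (rule new[symmetric], simp)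
  qed auto
  have Un: "{0..T} \<union> {T..T + s} = {0..T + s}" using T s by auto
  have sub: "?\<delta> r \<in> S3" if "r \<in> {0..T + s}" for r
  proof (cases "r \<le> T")
    case True
    then have "\<gamma> r \<in> S3" using that by (intro subsetD[OF S] imageI) simp
    then show ?thesis using True by simp
  next
    case False
    then have "\<sigma> (r - T) \<in> S3" using \<sigma>(3) that by (intro subsetD[OF \<sigma>(3)] imageI) auto
    then show ?thesis using False by simp
  qed
  have ends: "t' 0 = 0" "t' (Suc n) = T + s" using t by (auto simp: t'_def)
  show ?thesis
    unfolding trajectory_def
  proof (intro conjI exI[of _ "Suc n"] exI[of _ t'] allI impI)
    show "continuous_on {0..T + s} ?\<delta>" using cont unfolding Un .
    show "?\<delta> ` {0..T + s} \<subseteq> S3" using sub by (rule image_subsetI)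
  qed (use T s ends mono pieces in simp_all)
qed

lemma trajectory_const: "x \<in> S3 \<Longrightarrow> trajectory \<Gamma> 0 (\<lambda>_. x)"
  unfolding trajectory_def by (auto intro!: exI[of _ "0::nat"])

lemma positive_orbit_self: "x \<in> S3 \<Longrightarrow> x \<in> positive_orbit \<Gamma> x"
  unfolding positive_orbit_def using trajectory_const by blast

lemma positive_orbit_subset_sphere: "positive_orbit \<Gamma> x \<subseteq> S3"
proof
  fix y assume "y \<in> positive_orbit \<Gamma> x"
  then obtain T \<gamma> where \<gamma>: "trajectory \<Gamma> T \<gamma>" "\<gamma> T = y"
    unfolding positive_orbit_def by blast
  then have "\<gamma> ` {0..T} \<subseteq> S3" "T \<in> {0..T}" by (simp_all add: trajectory_def)
  then show "y \<in> S3" using \<gamma>(2) by blast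
qed

lemma positive_orbit_flow:
  assumes y: "y \<in> positive_orbit \<Gamma> x" and X: "vfield (N *\<^sub>R u) \<in> \<Gamma>"
    and N: "0 < N" and u: "norm u = 1" and s: "0 \<le> s"
  shows "flow u s y \<in> positive_orbit \<Gamma> x"
proof (cases "s = 0")
  case True then show ?thesis using y by (simp add: flow_0)
next
  case False
  obtain T \<gamma> where \<gamma>: "trajectory \<Gamma> T \<gamma>" "\<gamma> 0 = x" "\<gamma> T = y"
    using y unfolding positive_orbit_def by blast
  have y1: "norm y = 1" using subsetD[OF positive_orbit_subset_sphere y] by simp
  define r where "r = s / N"
  have r: "0 < r" "N * r = s" using False s N by (simp_all add: r_def)
  define \<sigma> where "\<sigma> = (\<lambda>t. flow u (N * t) y)"
  have "trajectory \<Gamma> (T + r) (\<lambda>t. if t \<le> T then \<gamma> t else \<sigma> (t - T))"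
    using norm_flow[OF u y1] \<gamma>(3)
    by (intro trajectory_append[OF \<gamma>(1) X r(1)]) (auto simp: \<sigma>_def integral_curve_on_flow[OF u y1] flow_0)
  moreover have "0 \<le> T" using \<gamma>(1) by (simp add: trajectory_def)
  ultimately show ?thesis
    unfolding positive_orbit_def using r \<gamma>(2) by (force simp: \<sigma>_def)
qed

lemma infinite_trajectory_flow:
  assumes x: "x \<in> S3" and X: "vfield (N *\<^sub>R u) \<in> \<Gamma>" and u: "norm u = 1"
  shows "infinite_trajectory \<Gamma> (\<lambda>t. flow u (N * t) x)"
  unfolding infinite_trajectory_def
proof (intro allI impI)
  fix T :: real assume T: "0 \<le> T"
  have x1: "norm x = 1" using x by simp
  let ?\<gamma> = "\<lambda>t. flow u (N * t) x"
  have c: "continuous_on {0..T} ?\<gamma>" and S: "?\<gamma> ` {0..T} \<subseteq> S3"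
    using continuous_on_integral_curve[OF integral_curve_on_flow[OF u x1]] norm_flow[OF u x1] by auto
  show "trajectory \<Gamma> T ?\<gamma>"
  proof (cases "T = 0")
    case True then show ?thesis
      unfolding trajectory_def using c S by (auto intro!: exI[of _ "0::nat"])
  next
    case False
    have "\<exists>X\<in>\<Gamma>. integral_curve_on X 0 T ?\<gamma>" using integral_curve_on_flow[OF u x1] X by blast
    then show ?thesis
      unfolding trajectory_def using c S T False
      by (intro conjI exI[of _ "1::nat"] exI[of _ "\<lambda>i. if i = 0 then 0 else T"]) simp_all
  qed
qed

text \<open>
  Along the curve \<open>f = v \<bullet> \<gamma>\<close> satisfies \<open>f' = v \<bullet> q - (q \<bullet> \<gamma>) f\<close>. With the integrating factor
  \<open>exp h\<close>, where \<open>h' = q \<bullet> \<gamma>\<close>, this reads \<open>(exp h * f)' = exp h * (v \<bullet> q) \<ge> 0\<close>, so the sign of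
  \<open>f\<close> at the start survives.
\<close>

lemma halfspace_invariant_integral_curve:
  assumes X: "integral_curve_on (vfield q) a b \<gamma>" and ab: "a \<le> b" and S: "\<gamma> ` {a..b} \<subseteq> S3"
    and vq: "0 \<le> v \<bullet> q" and va: "0 \<le> v \<bullet> \<gamma> a"
  shows "0 \<le> v \<bullet> \<gamma> b"
proof -
  define c where "c = (\<lambda>s. q \<bullet> \<gamma> s)"
  define h where "h = (\<lambda>s. integral {a..s} c)"
  have cont: "continuous_on {a..b} \<gamma>" using continuous_on_integral_curve[OF X] .
  then have "continuous_on {a..b} c" unfolding c_def by (intro continuous_intros)
  then have h: "(h has_real_derivative c s) (at s within {a..b})" if "s \<in> {a..b}" for s
    unfolding h_def using integral_has_real_derivative that by blast
  define F where "F = (\<lambda>s. exp (h s) * (v \<bullet> \<gamma> s))"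
  have F: "(F has_real_derivative exp (h s) * (v \<bullet> q)) (at s within {a..b})" if s: "s \<in> {a..b}" for s
  proof -
    have "(\<gamma> has_vector_derivative q - c s *\<^sub>R \<gamma> s) (at s within {a..b})"
      using X S s unfolding integral_curve_on_def c_def by (metis image_subset_iff vfield_eq_projection)
    from bounded_linear.has_vector_derivative[OF bounded_linear_inner_right this, of v]
    have "((\<lambda>s. v \<bullet> \<gamma> s) has_real_derivative v \<bullet> q - c s * (v \<bullet> \<gamma> s)) (at s within {a..b})"
      by (simp add: has_real_derivative_iff_has_vector_derivative inner_diff_right)
    from DERIV_mult[OF DERIV_chain2[OF DERIV_exp h[OF s]] this]
    show ?thesis unfolding F_def by (simp add: algebra_simps)
  qed
  have "F a \<le> F b"
  proof (rule DERIV_nonneg_imp_increasing_open[OF ab])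
    fix s assume "a < s" "s < b"
    then show "\<exists>y. (F has_real_derivative y) (at s) \<and> 0 \<le> y"
      using F[of s] vq by (auto simp: at_within_Icc_at)
  next
    show "continuous_on {a..b} F"
      using F by (meson DERIV_continuous continuous_on_eq_continuous_within)
  qed
  moreover have "0 \<le> F a" using va by (simp add: F_def)
  ultimately have "0 \<le> exp (h b) * (v \<bullet> \<gamma> b)" by (simp add: F_def)
  then show ?thesis by (simp add: zero_le_mult_iff)
qed

lemma positive_orbit_halfspace:
  assumes \<Gamma>: "\<And>X. X \<in> \<Gamma> \<Longrightarrow> \<exists>q. X = vfield q \<and> 0 \<le> v \<bullet> q"
    and x: "0 \<le> v \<bullet> x" and y: "y \<in> positive_orbit \<Gamma> x"
  shows "0 \<le> v \<bullet> y"
proof -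
  obtain T \<gamma> where tr: "trajectory \<Gamma> T \<gamma>" and \<gamma>: "\<gamma> 0 = x" "\<gamma> T = y"
    using y unfolding positive_orbit_def by blast
  obtain n t where S: "\<gamma> ` {0..T} \<subseteq> S3"
    and t: "t 0 = 0" "t n = T" "\<And>i. i < n \<Longrightarrow> t i < t (Suc i)"
    and X: "\<And>i. i < n \<Longrightarrow> \<exists>X\<in>\<Gamma>. integral_curve_on X (t i) (t (Suc i)) \<gamma>"
    using tr unfolding trajectory_def by blast
  have "i \<le> n \<Longrightarrow> 0 \<le> v \<bullet> \<gamma> (t i)" for i
  proof (induction i)
    case 0 then show ?case using x \<gamma> t by simp
  next
    case (Suc i)
    then obtain q where q: "integral_curve_on (vfield q) (t i) (t (Suc i)) \<gamma>" "0 \<le> v \<bullet> q"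
      using X[of i] \<Gamma> by fastforce
    have "0 \<le> t i" "t (Suc i) \<le> T"
      using switching_time_le[of n t 0 i] switching_time_le[of n t "Suc i" n] t Suc.prems by auto
    then have "\<gamma> ` {t i..t (Suc i)} \<subseteq> S3" using S by (auto simp: image_subset_iff)
    then show ?case
      using halfspace_invariant_integral_curve[OF q(1) _ _ q(2)] t(3)[of i] Suc by simp
  qed
  then show ?thesis using \<gamma> t by auto
qed

section \<open>The invariant control set of two flows\<close>

lemma dim_quat: "2 \<le> DIM(quat)" by simp

lemma spherical_segment_eq_dual:
  fixes p q :: "'a::euclidean_space"
  assumes "2 \<le> DIM('a)" "norm p = 1" "norm q = 1" "p \<noteq> - q"
  shows "spherical_segment p q = {x \<in> sphere 0 1. \<forall>v. 0 \<le> v \<bullet> p \<longrightarrow> 0 \<le> v \<bullet> q \<longrightarrow> 0 \<le> v \<bullet> x}"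
proof -
  obtain \<theta> w where "0 \<le> \<theta>" "\<theta> < pi" "norm w = 1" "p \<bullet> w = 0" "q = cos \<theta> *\<^sub>R p + sin \<theta> *\<^sub>R w"
    using orthonormal_direction[OF assms] .
  then show ?thesis using spherical_segment_arc_dual(2) assms(2) by blast
qed

lemma spherical_segment_inner_nonneg:
  assumes "x \<in> spherical_segment p q" "0 \<le> v \<bullet> p" "0 \<le> v \<bullet> q"
  shows "0 \<le> v \<bullet> x"
  using assms by (auto simp: spherical_segment_def inner_add_right)

lemma closed_spherical_segment:
  fixes p q :: "'a::euclidean_space"
  assumes "2 \<le> DIM('a)" "norm p = 1" "norm q = 1" "p \<noteq> - q"
  shows "closed (spherical_segment p q)"
proof -
  have "spherical_segment p q = sphere 0 1 \<inter> (\<Inter>v\<in>{v. 0 \<le> v \<bullet> p \<and> 0 \<le> v \<bullet> q}. {x. 0 \<le> v \<bullet> x})"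
    unfolding spherical_segment_eq_dual[OF assms] by auto
  then show ?thesis by (auto intro!: closed_Int closed_INT closed_halfspace_ge)
qed

lemma endpoints_in_spherical_segment:
  assumes "norm p = 1" "norm q = 1"
  shows "p \<in> spherical_segment p q" "q \<in> spherical_segment p q"
proof -
  have "p = 1 *\<^sub>R p + 0 *\<^sub>R q" "q = 0 *\<^sub>R p + 1 *\<^sub>R q" by simp_all
  then show "p \<in> spherical_segment p q" "q \<in> spherical_segment p q"
    unfolding spherical_segment_def using assms
    by (metis (mono_tags, lifting) mem_Collect_eq mem_sphere_0 zero_le_one order_refl)+
qed

text \<open>
  The point \<open>a *\<^sub>R p + b *\<^sub>R q\<close> with \<open>a > 0\<close> is reached when the coefficient \<open>k\<close> of \<open>q\<close> in the flow
  equals \<open>b / a\<close>, which happens by the intermediate value theorem, as \<open>k\<close> grows from \<open>0\<close> to infinity.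
  Both points are then unit vectors on the same ray. The endpoint \<open>q\<close> itself is only a limit.
\<close>

lemma flow_covers_spherical_segment:
  fixes p q :: "'a::real_inner"
  assumes p: "norm p = 1" and q: "norm q = 1" and ne: "p \<noteq> - q"
    and x: "x \<in> spherical_segment p q"
  shows "x = q \<or> (\<exists>t\<ge>0. flow q t p = x)"
proof -
  from x obtain a b where ab: "0 \<le> a" "0 \<le> b" "x = a *\<^sub>R p + b *\<^sub>R q" and nx: "norm x = 1"
    by (auto simp: spherical_segment_def)
  define c where "c = q \<bullet> p"
  define k where "k = (\<lambda>t. sinh t + c * (cosh t - 1))"
  have c: "-1 < c"
    using abs_inner_unit_le_1[OF q p] unit_inner_minus_one[OF p q] ne by (fastforce simp: c_def inner_commute)
  show ?thesis
  proof (cases "a = 0")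
    case True
    then have "b = 1" using ab nx q by simp
    then show ?thesis using True ab by simp
  next
    case False
    with ab have a: "0 < a" by simp
    have "filterlim k at_top at_top"
      using c unfolding k_def cosh_def sinh_def by simp real_asymp
    then have "\<forall>\<^sub>F t in at_top. b / a \<le> k t" by (simp add: filterlim_at_top)
    then obtain t1 where t1: "0 \<le> t1" "b / a \<le> k t1"
      using eventually_happens'[OF trivial_limit_at_top_linorder eventually_conj[OF _ eventually_ge_at_top[of 0]]]
      by blast
    have "\<exists>t\<ge>0. t \<le> t1 \<and> k t = b / a"
      by (rule IVT'[of k 0 "b / a" t1, OF _ t1(2,1)]) (use ab a in \<open>auto simp: k_def intro!: continuous_intros\<close>)
    then obtain t where t: "0 \<le> t" "k t = b / a" by blast
    define d where "d = cosh t + c * sinh t"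
    have d: "0 < d" unfolding d_def c_def by (rule flow_denominator_pos[OF abs_inner_unit_le_1[OF q p]])
    have "x = a *\<^sub>R (p + k t *\<^sub>R q)" using ab a t by (simp add: scaleR_add_right)
    moreover have f: "flow q t p = inverse d *\<^sub>R (p + k t *\<^sub>R q)"
      by (simp add: flow_def k_def d_def c_def)
    moreover have "norm (flow q t p) = 1" by (rule norm_flow[OF q p])
    ultimately have xd: "x = (a * d) *\<^sub>R flow q t p" using d by simp
    then have "1 = a * d" using nx \<open>norm (flow q t p) = 1\<close> a d by (metis abs_of_pos mult.right_neutral mult_pos_pos norm_scaleR)
    then show ?thesis using xd t by auto
  qed
qed

text \<open>
  First flow from \<open>y\<close> towards \<open>p\<close> for a long time \<open>s\<close>, then towards \<open>q\<close> for the time \<open>t\<close>. As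
  \<open>s\<close> tends to infinity, continuity of the second flow gives the limit \<open>flow q t p\<close>, and these points
  fill the segment up to \<open>q\<close>.
\<close>

lemma spherical_segment_subset_closure_positive_orbit:
  assumes p: "norm p = 1" and q: "norm q = 1" and ne: "p \<noteq> - q" and MN: "0 < M" "0 < N"
    and \<Gamma>: "vfield (M *\<^sub>R p) \<in> \<Gamma>" "vfield (N *\<^sub>R q) \<in> \<Gamma>"
    and y: "y \<in> positive_orbit \<Gamma> x" "y \<noteq> - p"
  shows "spherical_segment p q \<subseteq> closure (positive_orbit \<Gamma> x)"
proof -
  let ?K = "closure (positive_orbit \<Gamma> x)"
  have y1: "norm y = 1" using subsetD[OF positive_orbit_subset_sphere y(1)] by simp
  have fl: "flow q t p \<in> ?K" if t: "0 \<le> t" for t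
  proof (rule Lim_in_closed_set)
    show "\<forall>\<^sub>F s in at_top. flow q t (flow p s y) \<in> ?K"
      using eventually_ge_at_top[of 0]
    proof eventually_elim
      case (elim s)
      have "flow p s y \<in> positive_orbit \<Gamma> x" by (rule positive_orbit_flow[OF y(1) \<Gamma>(1) MN(1) p elim])
      from positive_orbit_flow[OF this \<Gamma>(2) MN(2) q t] show ?case using closure_subset by blast
    qed
    show "((\<lambda>s. flow q t (flow p s y)) \<longlongrightarrow> flow q t p) at_top"
      by (rule continuous_on_tendsto_compose[OF continuous_on_flow[OF q] flow_tendsto[OF p y1 y(2)]])
        (use p norm_flow[OF p y1] in auto)
  qed auto
  have "q \<in> ?K"
  proof (rule Lim_in_closed_set)
    show "((\<lambda>t. flow q t p) \<longlongrightarrow> q) at_top" by (rule flow_tendsto[OF q p ne])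
    show "\<forall>\<^sub>F t in at_top. flow q t p \<in> ?K" using eventually_ge_at_top[of 0] by eventually_elim (rule fl)
  qed auto
  then show ?thesis using flow_covers_spherical_segment[OF p q ne] fl by blast
qed

text \<open>
  The equilibrium \<open>- p\<close> of the first flow lies in the basin of \<open>q\<close>, so the second flow moves it away.
  This is where \<open>p \<noteq> q\<close> enters.
\<close>

lemma leave_antipode:
  assumes p: "norm p = 1" and q: "norm q = 1" and ne: "p \<noteq> - q" "p \<noteq> q" and N: "0 < N"
    and \<Gamma>: "vfield (N *\<^sub>R q) \<in> \<Gamma>" and x: "x \<in> S3"
  obtains y where "y \<in> positive_orbit \<Gamma> x" "y \<noteq> - p"
proof (cases "x = - p")
  case False
  then show thesis using that positive_orbit_self[OF x] by blast
next
  case True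
  have "((\<lambda>t. flow q t x) \<longlongrightarrow> q) at_top" using flow_tendsto[OF q, of x] x True ne by force
  then have "\<forall>\<^sub>F t in at_top. flow q t x \<noteq> - p"
    using ne by (intro tendsto_imp_eventually_ne) auto
  then have "\<forall>\<^sub>F t in at_top. 0 \<le> t \<and> flow q t x \<noteq> - p"
    using eventually_ge_at_top[of 0] by eventually_elim simp
  then obtain t where "0 \<le> t" "flow q t x \<noteq> - p"
    using eventually_happens'[OF trivial_limit_at_top_linorder] by blast
  then show thesis using that positive_orbit_flow[OF positive_orbit_self[OF x] \<Gamma> N q] by blast
qed

lemma positive_orbit_halfspace_two:
  assumes MN: "0 < M" "0 < N" and \<Gamma>: "\<Gamma> = {vfield (M *\<^sub>R p), vfield (N *\<^sub>R q)}"
    and "0 \<le> v \<bullet> p" "0 \<le> v \<bullet> q" "0 \<le> v \<bullet> x" "y \<in> positive_orbit \<Gamma> x"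
  shows "0 \<le> v \<bullet> y"
proof (rule positive_orbit_halfspace[OF _ assms(6,7)])
  fix X assume "X \<in> \<Gamma>"
  then show "\<exists>q. X = vfield q \<and> 0 \<le> v \<bullet> q"
    using assms by (metis inner_scaleR_right insertE less_imp_le mult_nonneg_nonneg singletonD)
qed

text \<open>
  Every orbit that starts in the segment has the segment as its closure. A larger set with the density
  property then has the same closure as the orbit of \<open>p\<close>, so it cannot be larger.
\<close>

lemma invariant_control_set_spherical_segment:
  assumes p: "norm p = 1" and q: "norm q = 1" and ne: "p \<noteq> - q" and MN: "0 < M" "0 < N"
    and \<Gamma>: "\<Gamma> = {vfield (M *\<^sub>R p), vfield (N *\<^sub>R q)}"
  shows "invariant_control_set \<Gamma> (spherical_segment p q)" (is "invariant_control_set _ ?C")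
proof -
  note dual = spherical_segment_eq_dual[OF dim_quat p q ne]
  have mem: "vfield (M *\<^sub>R p) \<in> \<Gamma>" "vfield (N *\<^sub>R q) \<in> \<Gamma>" using \<Gamma> by auto
  have CS: "?C \<subseteq> S3" by (auto simp: spherical_segment_def)
  have pC: "p \<in> ?C" using endpoints_in_spherical_segment[OF p q] by blast
  have inv: "positive_orbit \<Gamma> x \<subseteq> ?C" if x: "x \<in> ?C" for x
    using x positive_orbit_halfspace_two[OF MN \<Gamma>] positive_orbit_subset_sphere unfolding dual by blast
  have ap: "x \<noteq> - p" if "x \<in> ?C" for x
  proof
    assume "x = - p"
    moreover have m: "(p + q) \<bullet> p = 1 + p \<bullet> q" "(p + q) \<bullet> q = 1 + p \<bullet> q"
      using p q by (simp_all add: inner_add_left norm_eq_1 inner_commute[of q p])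
    moreover have "0 \<le> 1 + p \<bullet> q" using abs_inner_unit_le_1[OF p q] by linarith
    then have "0 \<le> (p + q) \<bullet> x" using spherical_segment_inner_nonneg[OF that, of "p + q"] m by simp
    ultimately have "p \<bullet> q = -1" using \<open>0 \<le> 1 + p \<bullet> q\<close> by simp
    then show False using unit_inner_minus_one[OF p q] ne by blast
  qed
  have cl: "closure (positive_orbit \<Gamma> x) = ?C" if x: "x \<in> ?C" for x
  proof
    show "closure (positive_orbit \<Gamma> x) \<subseteq> ?C"
      by (rule closure_minimal[OF inv[OF x] closed_spherical_segment[OF dim_quat p q ne]])
    show "?C \<subseteq> closure (positive_orbit \<Gamma> x)"
      using positive_orbit_self[of x] CS x ap[OF x]
      by (intro spherical_segment_subset_closure_positive_orbit[OF p q ne MN mem]) auto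
  qed
  have "viable \<Gamma> ?C"
    unfolding viable_def
  proof
    fix x assume x: "x \<in> ?C"
    then have xS: "x \<in> S3" using CS by blast
    have "flow p (M * t) x \<in> ?C" if "0 \<le> t" for t
      using positive_orbit_flow[OF positive_orbit_self[OF xS] mem(1) MN(1) p] that MN inv[OF x]
      by (meson less_imp_le mult_nonneg_nonneg subsetD)
    then show "\<exists>\<gamma>. infinite_trajectory \<Gamma> \<gamma> \<and> \<gamma> 0 = x \<and> (\<forall>t\<ge>0. \<gamma> t \<in> ?C)"
      using infinite_trajectory_flow[OF xS mem(1) p] by (force simp: flow_0)
  qed
  moreover have "orbit_dense \<Gamma> ?C"
    unfolding orbit_dense_def
    using cl closure_closed[OF closed_spherical_segment[OF dim_quat p q ne]] by simp
  moreover have "C' = ?C" if "?C \<subseteq> C'" "orbit_dense \<Gamma> C'" for C'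
  proof -
    have "closure C' = ?C" using that pC cl[OF pC] unfolding orbit_dense_def by blast
    then show ?thesis using that(1) closure_subset by blast
  qed
  ultimately show ?thesis unfolding invariant_control_set_def using CS pC by blast
qed

text \<open>
  The segment has empty interior, so a trajectory from outside need not enter it. Therefore the
  proof works with slightly enlarged half-spaces, which are neighbourhoods of \<open>p\<close> and still forward
  invariant: \<open>D\<close> returns arbitrarily near to \<open>p\<close>, hence lies in all of them.
\<close>

lemma invariant_control_set_unique:
  assumes p: "norm p = 1" and q: "norm q = 1" and ne: "p \<noteq> - q" "p \<noteq> q" and MN: "0 < M" "0 < N"
    and \<Gamma>: "\<Gamma> = {vfield (M *\<^sub>R p), vfield (N *\<^sub>R q)}" and D: "invariant_control_set \<Gamma> D"
  shows "D = spherical_segment p q" (is "_ = ?C")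
proof -
  note dual = spherical_segment_eq_dual[OF dim_quat p q ne(1)]
  have mem: "vfield (M *\<^sub>R p) \<in> \<Gamma>" "vfield (N *\<^sub>R q) \<in> \<Gamma>" using \<Gamma> by auto
  have DS: "D \<subseteq> S3" and dense: "orbit_dense \<Gamma> D" and "D \<noteq> {}"
    and max: "\<And>C'. D \<subseteq> C' \<Longrightarrow> C' \<subseteq> S3 \<Longrightarrow> viable \<Gamma> C' \<Longrightarrow> orbit_dense \<Gamma> C' \<Longrightarrow> C' = D"
    using D unfolding invariant_control_set_def by blast+
  then obtain x0 where x0: "x0 \<in> D" by blast
  obtain y where "y \<in> positive_orbit \<Gamma> x0" "y \<noteq> - p"
    using leave_antipode[OF p q ne MN(2) mem(2)] DS x0 by blast
  then have "p \<in> closure (positive_orbit \<Gamma> x0)"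
    using spherical_segment_subset_closure_positive_orbit[OF p q ne(1) MN mem]
      endpoints_in_spherical_segment[OF p q] by blast
  then have pD: "p \<in> closure D" using dense x0 unfolding orbit_dense_def by blast
  define m where "m = p + q"
  have "-1 < p \<bullet> q"
    using abs_inner_unit_le_1[OF p q] unit_inner_minus_one[OF p q] ne by (fastforce simp: abs_le_iff)
  then have m: "0 < m \<bullet> p" "0 < m \<bullet> q"
    using p q by (simp_all add: m_def inner_add_left norm_eq_1 inner_commute[of q p])
  have "D \<subseteq> ?C"
  proof
    fix x assume x: "x \<in> D"
    have "0 \<le> v \<bullet> x" if v: "0 \<le> v \<bullet> p" "0 \<le> v \<bullet> q" for v
    proof (rule field_le_epsilon)
      fix e :: real assume e: "0 < e"
      \<comment> \<open>The sum \<open>1 + \<bar>m \<bullet> x\<bar>\<close> only serves to avoid a zero denominator.\<close>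
      define \<epsilon> where "\<epsilon> = e / (1 + \<bar>m \<bullet> x\<bar>)"
      have \<epsilon>: "0 < \<epsilon>" "\<epsilon> * (m \<bullet> x) \<le> e"
      proof -
        show "0 < \<epsilon>" using e by (simp add: \<epsilon>_def)
        have "e * (m \<bullet> x) \<le> e * (1 + \<bar>m \<bullet> x\<bar>)" using e by (intro mult_left_mono) auto
        then show "\<epsilon> * (m \<bullet> x) \<le> e" by (simp add: \<epsilon>_def field_simps)
      qed
      define v' where "v' = v + \<epsilon> *\<^sub>R m"
      have v': "0 < v' \<bullet> p" "0 < v' \<bullet> q"
        using v m \<epsilon> by (simp_all add: v'_def inner_add_left add_nonneg_pos)
      have "open {y. 0 < v' \<bullet> y}" using open_halfspace_gt[of 0 v'] by simp
      then obtain y where y: "y \<in> D" "0 < v' \<bullet> y"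
        using pD v' open_Int_closure_eq_empty[of "{y. 0 < v' \<bullet> y}" D] by blast
      have "positive_orbit \<Gamma> y \<subseteq> {z. 0 \<le> v' \<bullet> z}"
        using positive_orbit_halfspace_two[OF MN \<Gamma> v'[THEN less_imp_le] y(2)[THEN less_imp_le]] by blast
      then have "closure (positive_orbit \<Gamma> y) \<subseteq> {z. 0 \<le> v' \<bullet> z}"
        using closed_halfspace_ge[of 0 v'] by (intro closure_minimal) auto
      moreover have "x \<in> closure (positive_orbit \<Gamma> y)"
        using dense x y closure_subset unfolding orbit_dense_def by blast
      ultimately have "0 \<le> v' \<bullet> x" by blast
      then show "0 \<le> v \<bullet> x + e" using \<epsilon> by (simp add: v'_def inner_add_left)
    qed
    then show "x \<in> ?C" unfolding dual using DS x by blast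
  qed
  then show ?thesis
    using max invariant_control_set_spherical_segment[OF p q ne(1) MN \<Gamma>]
    unfolding invariant_control_set_def by blast
qed

section \<open>Geodesics of the sphere\<close>

text \<open>
  With \<open>p = g 0\<close> and \<open>u = p \<bullet> g\<close>, the derivative of the angle \<open>arccos u\<close> is at most the speed, because
  only the part of \<open>p\<close> tangent to the sphere at \<open>g t\<close>, of norm \<open>sqrt (1 - u^2)\<close>, contributes to
  \<open>p \<bullet> g'\<close>. But \<open>arccos\<close> is not differentiable where \<open>u\<close> is \<open>1\<close> or \<open>-1\<close>, which already occurs at
  the start. Shrinking \<open>u\<close> to \<open>r * u\<close> with \<open>0 < r < 1\<close> removes these points and keeps the bound; then
  \<open>r\<close> tends to \<open>1\<close>.
\<close>

lemma angle_le_length_on_sphere: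
  assumes g: "valid_path g" and S: "path_image g \<subseteq> S3" and l: "has_length g l"
  shows "arccos (pathstart g \<bullet> pathfinish g) \<le> l"
proof -
  have n1: "norm (g t) = 1" if "t \<in> {0..1}" for t
    using subsetD[OF S[unfolded path_image_def] imageI[OF that]] by simp
  define p where "p = g 0"
  have p: "norm p = 1" unfolding p_def by (rule n1) simp
  define u where "u = (\<lambda>t. p \<bullet> g t)"
  have u1: "\<bar>u t\<bar> \<le> 1" if "t \<in> {0..1}" for t
    unfolding u_def by (rule abs_inner_unit_le_1[OF p n1[OF that]])
  have cg: "continuous_on {0..1} g" using valid_path_imp_path[OF g] by (simp add: path_def)
  obtain E where E: "finite E" "g C1_differentiable_on ({0..1} - E)"
    using g unfolding valid_path_def piecewise_C1_differentiable_on_def by blast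
  let ?g' = "\<lambda>t. vector_derivative g (at t)"
  have bound: "arccos (r * u 1) - arccos r \<le> l" if r: "r \<in> {0<..<1}" for r
  proof -
    have ru: "\<bar>r * u t\<bar> < 1" if "t \<in> {0..1}" for t
    proof -
      have "\<bar>r * u t\<bar> \<le> r * 1" using r u1[OF that] by (simp add: abs_mult)
      then show ?thesis using r by simp
    qed
    define F where "F = (\<lambda>t. arccos (r * u t))"
    \<comment> \<open>The value \<open>0\<close> at the finitely many bad points keeps \<open>F'\<close> below the speed everywhere.\<close>
    define F' where "F' = (\<lambda>t. if t \<in> {0<..<1} - E
      then - (r * (p \<bullet> ?g' t)) / sqrt (1 - (r * u t)\<^sup>2) else 0)"
    have cF: "continuous_on {0..1} F"
      unfolding F_def u_def
      by (intro continuous_on_arccos continuous_intros cg) (use ru in \<open>force simp: u_def abs_le_iff\<close>)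
    have g': "(g has_vector_derivative ?g' t) (at t)" if "t \<in> {0<..<1} - E" for t
      using E(2) that by (auto simp: C1_differentiable_on_eq vector_derivative_works[symmetric])
    have dF: "(F has_vector_derivative F' t) (at t)" if t: "t \<in> {0<..<1} - E" for t
    proof -
      have "((\<lambda>t. r * u t) has_real_derivative r * (p \<bullet> ?g' t)) (at t)"
        unfolding u_def has_real_derivative_iff_has_vector_derivative
        using has_vector_derivative_mult_right[OF
            bounded_linear.has_vector_derivative[OF bounded_linear_inner_right g'[OF t], of p], of r] .
      moreover have "-1 < r * u t" "r * u t < 1" using ru[of t] t by auto
      ultimately have "(F has_real_derivative inverse (- sqrt (1 - (r * u t)\<^sup>2)) * (r * (p \<bullet> ?g' t))) (at t)"
        unfolding F_def by (intro DERIV_chain2[OF DERIV_arccos]) auto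
      then show ?thesis
        using t by (simp add: F'_def has_real_derivative_iff_has_vector_derivative field_simps)
    qed
    have speed: "F' t \<le> norm (?g' t)" for t
    proof (cases "t \<in> {0<..<1} - E")
      case True
      then have t: "t \<in> {0..1}" by auto
      have gg: "g t \<bullet> g t = 1" using n1[OF t] by (simp add: norm_eq_1)
      have "((\<lambda>t. g t \<bullet> g t) has_vector_derivative 2 * (g t \<bullet> ?g' t)) (at t)"
        using bounded_bilinear.has_vector_derivative[OF bounded_bilinear_inner g'[OF True] g'[OF True]]
        by (simp add: inner_commute)
      moreover have "((\<lambda>t. g t \<bullet> g t) has_vector_derivative 0) (at t)"
        by (rule has_vector_derivative_transform_within_open[of "\<lambda>_. 1" _ _ "{0<..<1}"])
          (use True n1 in \<open>auto simp: norm_eq_1\<close>)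
      ultimately have orth: "g t \<bullet> ?g' t = 0" using vector_derivative_unique_at by fastforce
      define y where "y = p - u t *\<^sub>R g t"
      have "norm y = sqrt (1 - (u t)\<^sup>2)"
        using gg p unfolding norm_eq_sqrt_inner[of y]
        by (simp add: y_def inner_diff_left inner_diff_right norm_eq_1 u_def inner_commute power2_eq_square)
      moreover have "p \<bullet> ?g' t = y \<bullet> ?g' t" using orth by (simp add: y_def inner_diff_left)
      ultimately have 1: "\<bar>p \<bullet> ?g' t\<bar> \<le> sqrt (1 - (u t)\<^sup>2) * norm (?g' t)"
        using Cauchy_Schwarz_ineq2[of y "?g' t"] by simp
      have pos: "0 < sqrt (1 - (r * u t)\<^sup>2)" using ru[OF t] by (simp add: abs_square_less_1)
      have "r\<^sup>2 \<le> 1" using r by (simp add: power_le_one)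
      then have "r * sqrt (1 - (u t)\<^sup>2) \<le> sqrt (1 - (r * u t)\<^sup>2)"
        using r by (intro real_le_rsqrt) (use u1[OF t] in
          \<open>simp add: power_mult_distrib abs_square_le_1 right_diff_distrib\<close>)
      then have "r * sqrt (1 - (u t)\<^sup>2) * norm (?g' t) \<le> sqrt (1 - (r * u t)\<^sup>2) * norm (?g' t)"
        by (intro mult_right_mono) auto
      moreover have "- (r * (p \<bullet> ?g' t)) \<le> r * (sqrt (1 - (u t)\<^sup>2) * norm (?g' t))"
        using mult_left_mono[OF 1, of r] r by (auto simp: abs_le_iff abs_mult minus_le_iff)
          (smt (verit) mult_minus_right mult_left_mono)
      ultimately have "- (r * (p \<bullet> ?g' t)) \<le> norm (?g' t) * sqrt (1 - (r * u t)\<^sup>2)"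
        by (simp add: mult.commute mult.left_commute)
      then have "- (r * (p \<bullet> ?g' t)) / sqrt (1 - (r * u t)\<^sup>2) \<le> norm (?g' t)"
        by (simp only: pos_divide_le_eq[OF pos])
      then show ?thesis using True by (simp only: F'_def if_True)
    next
      case False
      then have "F' t = 0" by (simp only: F'_def if_False)
      then show ?thesis by simp
    qed
    have "(F' has_integral F 1 - F 0) {0..1}"
      by (rule fundamental_theorem_of_calculus_interior_strong[OF E(1) zero_le_one dF cF])
    then have "F 1 - F 0 \<le> l"
      by (rule has_integral_le[OF _ l[unfolded has_length_def] speed])
    then show ?thesis using p by (simp add: F_def u_def p_def norm_eq_1)
  qed
  have u11: "\<bar>u 1\<bar> \<le> 1" by (rule u1) simp
  have "\<bar>r * u 1\<bar> \<le> 1" if "r \<in> {0..1}" for r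
    using u11 that by (simp add: abs_mult mult_le_one)
  then have ru1: "\<forall>r\<in>{0..1}. -1 \<le> r * u 1 \<and> r * u 1 \<le> 1" by (simp add: abs_le_iff minus_le_iff)
  have "continuous_on {0..1} (\<lambda>r. arccos (r * u 1) - arccos r)"
    by (intro continuous_on_diff continuous_on_arccos[OF _ ru1] continuous_on_arccos
        continuous_on_mult_right continuous_on_id) simp
  then have "arccos (1 * u 1) - arccos 1 \<le> l"
    using continuous_le_on_closure[of "{0<..<1}" "\<lambda>r. arccos (r * u 1) - arccos r" 1 l] bound by simp
  then show ?thesis by (simp add: u_def p_def pathstart_def pathfinish_def)
qed

text \<open>
  Differentiating \<open>\<gamma> \<bullet> \<gamma> = 1\<close> twice gives \<open>\<gamma> \<bullet> \<gamma>'' = -1\<close>, and the acceleration is normal to the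
  sphere, so \<open>\<gamma>'' = - \<gamma>\<close>. Then \<open>(\<gamma>, \<gamma>')\<close> rotates with unit angular speed, and rotating it back by
  the angle \<open>s\<close> yields the constants \<open>A\<close> and \<open>B\<close>.
\<close>

lemma unit_speed_geodesic_eq_great_circle:
  assumes "unit_speed_geodesic L \<gamma>" and L: "0 < L"
  obtains w where "norm w = 1" "\<gamma> 0 \<bullet> w = 0"
    "\<And>s. s \<in> {0..L} \<Longrightarrow> \<gamma> s = cos s *\<^sub>R \<gamma> 0 + sin s *\<^sub>R w"
proof -
  obtain \<gamma>1 \<gamma>2 where geo: "\<forall>s\<in>{0..L}. \<gamma> s \<in> S3 \<and>
        (\<gamma> has_vector_derivative \<gamma>1 s) (at s within {0..L}) \<and> norm (\<gamma>1 s) = 1 \<and>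
        (\<gamma>1 has_vector_derivative \<gamma>2 s) (at s within {0..L}) \<and>
        (\<forall>v. v \<bullet> \<gamma> s = 0 \<longrightarrow> \<gamma>2 s \<bullet> v = 0)"
    using assms(1) unfolding unit_speed_geodesic_def by blast
  have S: "norm (\<gamma> s) = 1" and n1: "norm (\<gamma>1 s) = 1"
    and d1: "(\<gamma> has_vector_derivative \<gamma>1 s) (at s within {0..L})"
    and d2: "(\<gamma>1 has_vector_derivative \<gamma>2 s) (at s within {0..L})"
    and tan: "\<And>v. v \<bullet> \<gamma> s = 0 \<Longrightarrow> \<gamma>2 s \<bullet> v = 0" if "s \<in> {0..L}" for s
    using bspec[OF geo that] by (simp_all only: mem_sphere_0)
  \<comment> \<open>One-sided derivatives at \<open>0\<close> and \<open>L\<close> are unique since \<open>L > 0\<close>.\<close>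
  have zero: "y = 0"
    if f: "(f has_vector_derivative y) (at s within {0..L})" and s: "s \<in> {0..L}"
      and c: "\<And>r. r \<in> {0..L} \<Longrightarrow> f r = c" for f :: "real \<Rightarrow> real" and y s c
  proof -
    have "(f has_vector_derivative 0) (at s within {0..L})"
      by (rule has_vector_derivative_transform[OF s, of _ "\<lambda>_. c"]) (use c in auto)
    then show ?thesis
      using vector_derivative_unique_within_closed_interval[of 0 L s f y 0] L f s by simp
  qed
  have orth: "\<gamma> s \<bullet> \<gamma>1 s = 0" if s: "s \<in> {0..L}" for s
  proof -
    have "\<gamma> s \<bullet> \<gamma>1 s + \<gamma>1 s \<bullet> \<gamma> s = 0"
      using bounded_bilinear.has_vector_derivative[OF bounded_bilinear_inner d1[OF s] d1[OF s]]
      by (rule zero[OF _ s, of _ _ 1]) (use S in \<open>simp add: norm_eq_1\<close>)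
    then show ?thesis by (simp add: inner_commute)
  qed
  have acc: "\<gamma>2 s = - \<gamma> s" if s: "s \<in> {0..L}" for s
  proof -
    have "\<gamma> s \<bullet> \<gamma>2 s + \<gamma>1 s \<bullet> \<gamma>1 s = 0"
      using bounded_bilinear.has_vector_derivative[OF bounded_bilinear_inner d1[OF s] d2[OF s]]
      by (rule zero[OF _ s, of _ _ 0]) (use orth in simp)
    then have v: "(\<gamma>2 s + \<gamma> s) \<bullet> \<gamma> s = 0"
      using S[OF s] n1[OF s] by (simp add: norm_eq_1 inner_add_left inner_commute[of "\<gamma>2 s" "\<gamma> s"])
    then have "(\<gamma>2 s + \<gamma> s) \<bullet> (\<gamma>2 s + \<gamma> s) = 0"
      using tan[OF s v] by (simp add: inner_add_left inner_add_right inner_commute)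
    then show ?thesis by (simp add: eq_neg_iff_add_eq_0)
  qed
  define A B where "A = (\<lambda>s. cos s *\<^sub>R \<gamma> s - sin s *\<^sub>R \<gamma>1 s)"
    and "B = (\<lambda>s. sin s *\<^sub>R \<gamma> s + cos s *\<^sub>R \<gamma>1 s)"
  have cd: "(cos has_real_derivative - sin s) (at s within {0..L})"
    "(sin has_real_derivative cos s) (at s within {0..L})" for s
    by (auto intro!: derivative_eq_intros)
  have "(A has_vector_derivative 0) (at s within {0..L})" if s: "s \<in> {0..L}" for s
    using has_vector_derivative_diff[OF has_vector_derivative_scaleR[OF cd(1) d1[OF s]]
        has_vector_derivative_scaleR[OF cd(2) d2[OF s]]]
    unfolding A_def by (simp add: acc[OF s])
  then obtain a where a: "\<And>s. s \<in> {0..L} \<Longrightarrow> A s = a"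
    using has_vector_derivative_zero_constant[of "{0..L}" A] by auto
  have "(B has_vector_derivative 0) (at s within {0..L})" if s: "s \<in> {0..L}" for s
    using has_vector_derivative_add[OF has_vector_derivative_scaleR[OF cd(2) d1[OF s]]
        has_vector_derivative_scaleR[OF cd(1) d2[OF s]]]
    unfolding B_def by (simp add: acc[OF s])
  then obtain b where b: "\<And>s. s \<in> {0..L} \<Longrightarrow> B s = b"
    using has_vector_derivative_zero_constant[of "{0..L}" B] by auto
  have 0: "0 \<in> {0..L}" using L by simp
  have ab: "a = \<gamma> 0" "b = \<gamma>1 0" using a[OF 0] b[OF 0] by (simp_all add: A_def B_def)
  show thesis
  proof (rule that)
    show "norm (\<gamma>1 0) = 1" "\<gamma> 0 \<bullet> \<gamma>1 0 = 0" using n1[OF 0] orth[OF 0] by auto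
    fix s assume s: "s \<in> {0..L}"
    have "cos s *\<^sub>R A s + sin s *\<^sub>R B s = (cos s * cos s) *\<^sub>R \<gamma> s + (sin s * sin s) *\<^sub>R \<gamma> s"
      by (simp add: A_def B_def algebra_simps)
    also have "\<dots> = (cos s * cos s + sin s * sin s) *\<^sub>R \<gamma> s" by (simp only: scaleR_left_distrib)
    also have "\<dots> = \<gamma> s" by (simp only: sin_cos_squared_add3 scaleR_one)
    finally show "\<gamma> s = cos s *\<^sub>R \<gamma> 0 + sin s *\<^sub>R \<gamma>1 0" using a[OF s] b[OF s] ab by simp
  qed
qed

lemma has_vector_derivative_great_circle:
  fixes p w :: "'a::real_normed_vector"
  shows "((\<lambda>s. cos (c * s) *\<^sub>R p + sin (c * s) *\<^sub>R w) has_vector_derivative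
    c *\<^sub>R (- sin (c * s) *\<^sub>R p + cos (c * s) *\<^sub>R w)) (at s within S)"
proof -
  have "((\<lambda>s. cos (c * s)) has_real_derivative - c * sin (c * s)) (at s within S)"
    "((\<lambda>s. sin (c * s)) has_real_derivative c * cos (c * s)) (at s within S)"
    by (auto intro!: derivative_eq_intros)
  then show ?thesis
    by (auto intro!: derivative_eq_intros simp: scaleR_add_right scaleR_diff_right mult.commute)
qed

lemma great_circle_arc_valid_path_length:
  fixes p w :: quat
  assumes pw: "norm p = 1" "norm w = 1" "p \<bullet> w = 0" and \<theta>: "0 \<le> \<theta>"
  defines "g \<equiv> \<lambda>t. cos (\<theta> * t) *\<^sub>R p + sin (\<theta> * t) *\<^sub>R w"
  shows "valid_path g" "path_image g \<subseteq> S3" "has_length g \<theta>"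
proof -
  let ?g' = "\<lambda>t. \<theta> *\<^sub>R (- sin (\<theta> * t) *\<^sub>R p + cos (\<theta> * t) *\<^sub>R w)"
  have g': "(g has_vector_derivative ?g' t) (at t)" for t
    unfolding g_def by (rule has_vector_derivative_great_circle)
  have "continuous_on {0..1} ?g'" by (intro continuous_intros)
  then have "g C1_differentiable_on {0..1}" 
    unfolding C1_differentiable_on_def using g' by (intro exI[of _ ?g'] conjI ballI)
  then show "valid_path g" unfolding valid_path_def by (rule C1_differentiable_imp_piecewise)
  show "path_image g \<subseteq> S3"
    using cos_add_sin_in_sphere[OF pw] by (auto simp: path_image_def g_def)
  have "norm (- sin (\<theta> * t) *\<^sub>R p + cos (\<theta> * t) *\<^sub>R w) = 1" for t
    using cos_add_sin_in_sphere[OF pw, of "\<theta> * t + pi / 2"] by (simp add: cos_add sin_add)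
  then have "norm (vector_derivative g (at t)) = \<theta>" for t
    using \<theta> by (simp add: vector_derivative_at[OF g'])
  then show "has_length g \<theta>"
    unfolding has_length_def using has_integral_const_real[of \<theta> 0 1] by simp
qed

text \<open>
  The arc has length \<open>\<theta>\<close>, the angle between the endpoints, so it is minimal. Any other minimal
  geodesic is no longer than \<open>\<theta>\<close>, hence shorter than \<open>\<pi>\<close>; it is therefore itself an arc with polar
  coordinates of \<open>q\<close> about \<open>p\<close>, and its image is the same cone section.
\<close>

lemma minimal_geodesic_segment_iff:
  assumes p: "norm p = 1" and q: "norm q = 1" and ne: "p \<noteq> - q"
  shows "minimal_geodesic_segment p q C \<longleftrightarrow> C = spherical_segment p q"
proof -
  obtain \<theta> w where \<theta>: "0 \<le> \<theta>" "\<theta> < pi" and w: "norm w = 1" "p \<bullet> w = 0"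
    and qe: "q = cos \<theta> *\<^sub>R p + sin \<theta> *\<^sub>R w"
    using orthonormal_direction[OF dim_quat p q ne] .
  let ?\<gamma> = "\<lambda>s. cos s *\<^sub>R p + sin s *\<^sub>R w"
  have pq: "p \<bullet> q = cos \<theta>" using p w by (simp add: qe inner_add_right norm_eq_1)
  note path = great_circle_arc_valid_path_length[OF p w \<theta>(1)]
  have arc: "?\<gamma> ` {0..\<theta>} = spherical_segment p q"
    using spherical_segment_arc_dual(1)[OF p w \<theta> qe] .
  show ?thesis
  proof
    assume C: "C = spherical_segment p q"
    have "unit_speed_geodesic \<theta> ?\<gamma>"
      unfolding unit_speed_geodesic_def
    proof (intro conjI exI ballI allI impI)
      fix s
      show "?\<gamma> s \<in> S3" using cos_add_sin_in_sphere[OF p w] by simp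
      show "(?\<gamma> has_vector_derivative - sin s *\<^sub>R p + cos s *\<^sub>R w) (at s within {0..\<theta>})"
        using has_vector_derivative_great_circle[of 1 p w s] by simp
      show "norm (- sin s *\<^sub>R p + cos s *\<^sub>R w) = 1"
        using cos_add_sin_in_sphere[OF p w, of "s + pi / 2"] by (simp add: cos_add sin_add)
      show "((\<lambda>s. - sin s *\<^sub>R p + cos s *\<^sub>R w) has_vector_derivative - ?\<gamma> s) (at s within {0..\<theta>})"
        using has_vector_derivative_great_circle[of 1 w "- p" s] by (simp add: algebra_simps)
      show "- ?\<gamma> s \<bullet> v = 0" if "v \<bullet> ?\<gamma> s = 0" for v
        using that by (metis inner_commute inner_minus_left minus_zero)
    qed (rule \<theta>(1))
    moreover have "\<theta> \<le> l" if "valid_path g" "path_image g \<subseteq> S3" "pathstart g = p" "pathfinish g = q" "has_length g l" for g l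
      using angle_le_length_on_sphere[OF that(1,2,5)] that(3,4) pq \<theta> by (simp add: arccos_cos)
    ultimately show "minimal_geodesic_segment p q C"
      unfolding minimal_geodesic_segment_def C arc[symmetric] using qe
      by (intro exI[of _ \<theta>] exI[of _ ?\<gamma>]) auto
  next
    assume "minimal_geodesic_segment p q C"
    then obtain L \<gamma> where \<gamma>: "unit_speed_geodesic L \<gamma>" "\<gamma> 0 = p" "\<gamma> L = q" and C: "C = \<gamma> ` {0..L}"
      and min: "\<And>g l. valid_path g \<Longrightarrow> path_image g \<subseteq> S3 \<Longrightarrow> pathstart g = p \<Longrightarrow> pathfinish g = q \<Longrightarrow>
           has_length g l \<Longrightarrow> L \<le> l"
      unfolding minimal_geodesic_segment_def by blast
    have "L \<le> \<theta>" by (rule min[OF path(1,2) _ _ path(3)]) (simp_all add: pathstart_def pathfinish_def qe)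
    have "0 \<le> L" using \<gamma>(1) by (simp add: unit_speed_geodesic_def)
    show "C = spherical_segment p q"
    proof (cases "L = 0")
      case True
      then have "q = p" using \<gamma> by simp
      then have "cos \<theta> = 1" using pq p by (simp add: norm_eq_1)
      then have "\<theta> = 0" using \<theta> by (metis arccos_1 arccos_cos less_imp_le)
      then show ?thesis using arc C True \<gamma> by simp
    next
      case False
      then obtain w' where w': "norm w' = 1" "p \<bullet> w' = 0"
        and \<gamma>e: "\<And>s. s \<in> {0..L} \<Longrightarrow> \<gamma> s = cos s *\<^sub>R p + sin s *\<^sub>R w'"
        using unit_speed_geodesic_eq_great_circle[OF \<gamma>(1)] \<gamma>(2) \<open>0 \<le> L\<close> by (metis order_le_less)
      have "q = cos L *\<^sub>R p + sin L *\<^sub>R w'" using \<gamma>e[of L] \<gamma>(3) \<open>0 \<le> L\<close> by simp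
      from spherical_segment_arc_dual(1)[OF p w' \<open>0 \<le> L\<close> _ this]
      show ?thesis using \<gamma>e C \<open>L \<le> \<theta>\<close> \<theta> by (simp cong: image_cong_simp)
    qed
  qed
qed

section \<open>The two fields with opposite imaginary parts\<close>

theorem theorem5p2:
  fixes z p1 p2 :: quat and \<Gamma> :: "(quat \<Rightarrow> quat) set"
  assumes "z \<in> ImH"
    and "p1 = (qone + z) /\<^sub>R norm (qone + z)"
    and "p2 = (qone - z) /\<^sub>R norm (qone - z)"
    and "\<Gamma> = {vfield (qone + z), vfield (qone - z)}"
  shows "(\<exists>!C. minimal_geodesic_segment p1 p2 C) \<and>
         (\<forall>C. minimal_geodesic_segment p1 p2 C \<longrightarrow>
            invariant_control_set \<Gamma> C \<and>
            (z \<noteq> 0 \<longrightarrow> (\<forall>D. invariant_control_set \<Gamma> D \<longrightarrow> D = C)))"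
proof -
  define M N where "M = norm (qone + z)" and "N = norm (qone - z)"
  have z: "fst z = 0" using assms(1) by (simp add: ImH_def)
  have "fst (qone + z) = 1" "fst (qone - z) = 1" using z by (simp_all add: qone_def)
  then have "qone + z \<noteq> 0" "qone - z \<noteq> 0" by (metis fst_zero zero_neq_one)+
  then have MN: "0 < M" "0 < N" by (simp_all add: M_def N_def)
  have n: "norm p1 = 1" "norm p2 = 1" using MN by (simp_all add: assms(2,3) M_def N_def)
  have sc: "M *\<^sub>R p1 = qone + z" "N *\<^sub>R p2 = qone - z"
    using MN by (simp_all add: assms(2,3) M_def N_def)
  \<comment> \<open>Positive scalar parts exclude that the two poles are antipodal.\<close>
  have "fst p1 = 1 / M" "fst p2 = 1 / N"
    using z by (simp_all add: assms(2,3) M_def N_def qone_def divide_inverse)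
  then have ne: "p1 \<noteq> - p2" using MN
    by (metis add_pos_pos fst_uminus add.right_inverse less_irrefl zero_less_divide_1_iff)
  have \<Gamma>: "\<Gamma> = {vfield (M *\<^sub>R p1), vfield (N *\<^sub>R p2)}" using assms(4) sc by simp
  have "p1 \<noteq> p2" if "z \<noteq> 0"
  proof
    assume "p1 = p2"
    then have "M = N" using \<open>fst p1 = 1 / M\<close> \<open>fst p2 = 1 / N\<close> MN by simp
    then have "qone + z = qone - z" using sc \<open>p1 = p2\<close> by simp
    then have "(2::real) *\<^sub>R z = 0" by (simp add: scaleR_2 algebra_simps)
    then show False using that by simp
  qed
  then show ?thesis
    using minimal_geodesic_segment_iff[OF n ne] invariant_control_set_spherical_segment[OF n ne MN \<Gamma>]
      invariant_control_set_unique[OF n ne _ MN \<Gamma>] by simp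
qed

end
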